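(* Let $q$ be a power of a prime $p$ and let $n,d\in\mathbb{Z}_{\geq 1}$. Then \[ \Delta_d(q^n+1,q^n)=\mathrm{Int}\Bigl(\frac{2}{q}\Bigr)S_d(2,2q^n-1)-\sum_{j=1}^{\frac{q^n-1}{q-1}}S_d\Bigl(3+(j-1)(q-1),\,2q^n-2-(j-1)(q-1)\Bigr). \]
   Context: $\mathbb{F}_q$ is the finite field with $q$ elements, $A=\mathbb{F}_q[t]$, and $A_{d+}$ is the set of monic polynomials in $A$ of degree $d$. For $s\in\mathbb{Z}$ and $d\in\mathbb{Z}_{\geq0}$, $S_d(s)=\sum_{a\in A_{d+}}a^{-s}\in\mathbb{F}_q(t)$. For $s_1,s_2\in\mathbb{Z}_{>0}$ and $d\in\mathbb{Z}_{\geq 0}$, $S_d(s_1,s_2)=S_d(s_1)\sum_{d>d_2\geq 0}S_{d_2}(s_2)$. For $a,b\in\mathbb{Z}_{>0}$, $\Delta_d(a,b)=S_d(a)S_d(b)-S_d(a+b)$. $\mathrm{Int}(x)=1$ if $x$ is an integer and $0$ otherwise (so $\mathrm{Int}(2/q)=1$ exactly when $q=2$). *)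

theory Defs
  imports
    "HOL-Computational_Algebra.Computational_Algebra"
    "HOL-Library.Cardinality"
begin

text \<open>
  The field \<open>\<bbbF>\<^sub>q\<close> is a type \<open>'a\<close> of class \<open>finite_field\<close> with \<open>q = CARD('a)\<close>;
  \<open>A = \<bbbF>\<^sub>q[t]\<close> is \<open>'a poly\<close> and \<open>\<bbbF>\<^sub>q(t)\<close> is its fraction field \<open>'a poly fract\<close>.
\<close>

definition monic_polys :: "nat \<Rightarrow> 'a::finite_field poly set" where
  "monic_polys d = {a. degree a = d \<and> lead_coeff a = 1}"

lemma finite_monic_polys: "finite (monic_polys d :: 'a::finite_field poly set)"
proof (rule finite_subset)
  show "(monic_polys d :: 'a poly set) \<subseteq> Poly ` {xs. set xs \<subseteq> UNIV \<and> length xs \<le> Suc d}"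
  proof
    fix a :: "'a poly" assume "a \<in> monic_polys d"
    then have "length (coeffs a) \<le> Suc d"
      by (cases "a = 0") (auto simp: monic_polys_def length_coeffs_degree)
    then show "a \<in> Poly ` {xs. set xs \<subseteq> UNIV \<and> length xs \<le> Suc d}"
      by (intro image_eqI[of _ _ "coeffs a"]) simp_all
  qed
  show "finite (Poly ` {xs :: 'a list. set xs \<subseteq> UNIV \<and> length xs \<le> Suc d})"
    by (intro finite_imageI finite_lists_length_le) simp
qed

definition S :: "nat \<Rightarrow> int \<Rightarrow> 'a::finite_field poly fract" where
  "S d s = (\<Sum>a\<in>monic_polys d. to_fract a powi (- s))"

text \<open>
  The depth-two sums and \<open>\<Delta>\<close> are of interest for positive arguments only; they take
  integers so that argument expressions involve no truncated subtraction.
\<close>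

definition S2 :: "nat \<Rightarrow> int \<Rightarrow> int \<Rightarrow> 'a::finite_field poly fract" where
  "S2 d s1 s2 = S d s1 * (\<Sum>d2<d. S d2 s2)"

definition Delta :: "nat \<Rightarrow> int \<Rightarrow> int \<Rightarrow> 'a::finite_field poly fract" where
  "Delta d a b = S d a * S d b - S d (a + b)"

definition Int_ind :: "rat \<Rightarrow> nat" where
  "Int_ind x = (if x \<in> \<int> then 1 else 0)"

end

theory Submission
  imports Defs
begin

text \<open>
  The product \<open>S\<^sub>d(a) S\<^sub>d(b)\<close> is a sum over pairs \<open>(x, y)\<close> of monic polynomials of degree \<open>d\<close>;
  the diagonal gives \<open>S\<^sub>d(a + b)\<close>, so \<open>\<Delta>\<^sub>d(a, b)\<close> is the sum over \<open>y = x + f\<close> with \<open>f \<noteq> 0\<close> of degree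
  below \<open>d\<close>. For \<open>Q = q\<^sup>n\<close> the identity \<open>(1/x - 1/y)\<^sup>Q = 1/x\<^sup>Q - 1/y\<^sup>Q\<close> makes the
  partial fractions of \<open>1/(x\<^bsup>Q+1\<^esup> y\<^sup>Q)\<close> in terms of \<open>1/f\<close> have coefficients \<open>\<plusminus>1\<close>. Summing
  over \<open>x\<close> and \<open>f\<close> leaves the terms \<open>S\<^sub>d(k) \<Sum>\<^sub>f 1/f\<^bsup>2Q+1-k\<^esup>\<close> with \<open>2 \<le> k \<le> Q + 1\<close>. Splitting
  off the leading coefficient of \<open>f\<close>, the inner sum vanishes unless \<open>q - 1\<close> divides \<open>2Q + 1 - k\<close>,
  that is \<open>k \<equiv> 3\<close> modulo \<open>q - 1\<close>, and the value \<open>k = 2\<close> occurs only for \<open>q = 2\<close>, where signs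
  do not matter.
\<close>

section \<open>Characteristic and power sums of a finite field\<close>

lemma of_nat_card_finite_field: "of_nat CARD('a) = (0 :: 'a::finite_field)"
proof -
  have "(\<Sum>x\<in>UNIV. x + 1) = (\<Sum>x\<in>(UNIV :: 'a set). x)"
    by (rule sum.reindex_bij_witness[of _ "\<lambda>x. x - 1" "\<lambda>x. x + 1"]) auto
  then show ?thesis
    by (simp add: sum.distrib)
qed

lemma CHAR_finite_field:
  assumes "prime p" and "CARD('a::finite_field) = p ^ m"
  shows "CHAR('a) = p"
proof -
  have "CHAR('a) dvd p ^ m"
    using of_nat_card_finite_field[where 'a = 'a] assms(2) of_nat_eq_0_iff_char_dvd by metis
  then show ?thesis
    using assms(1) by (metis CHAR_prime prime_dvd_power primes_dvd_imp_eq)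
qed

lemma of_nat_fract: "of_nat n = to_fract (of_nat n)"
  by (induction n) simp_all

lemma to_fract_power: "to_fract (x ^ n) = to_fract x ^ n"
  by (induction n) simp_all

lemma CHAR_fract: "CHAR('a::idom fract) = CHAR('a)"
proof (rule CHAR_eqI)
  show "of_nat CHAR('a) = (0 :: 'a fract)"
    by (simp add: of_nat_fract)
next
  fix n assume "of_nat n = (0 :: 'a fract)"
  then show "CHAR('a) dvd n"
    by (simp add: of_nat_fract of_nat_eq_0_iff_char_dvd)
qed

lemma sum_to_fract_const: "(\<Sum>x\<in>X. to_fract [:f x:]) = to_fract [:\<Sum>x\<in>X. f x:]"
  by (induction X rule: infinite_finite_induct) (simp_all flip: to_fract_add)

text \<open>If \<open>CARD('a) - 1\<close> divides \<open>k\<close>, every summand is 1. Otherwise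
  some unit \<open>g\<close> has \<open>g ^ k \<noteq> 1\<close>; multiplication by \<open>g\<close>
  permutes the units and scales the sum by \<open>g ^ k\<close>, so the sum is 0.\<close>

lemma sum_power_units:
  "(\<Sum>c\<in>-{0}. c ^ k) = (if CARD('a) - 1 dvd k then - 1 else 0 :: 'a::finite_field)"
proof -
  define r where "r = CARD('a) - 1"
  have q: "CARD('a) = Suc r"
    by (simp add: r_def)
  have unit: "c ^ r = 1" if "c \<noteq> 0" for c :: 'a
    using finite_field_power_card_eq_same[of c] that by (simp add: q)
  show ?thesis
  proof (cases "r dvd k")
    case True
    then have "(\<Sum>c\<in>-{0}. c ^ k) = (\<Sum>c\<in>-{0 :: 'a}. 1 :: 'a)"
      by (intro sum.cong) (auto simp: power_mult unit elim!: dvdE)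
    also have "\<dots> = of_nat r"
      by (simp add: Compl_eq_Diff_UNIV card_Diff_subset r_def)
    also have "\<dots> = - 1"
      using of_nat_card_finite_field[where 'a = 'a] by (simp add: q eq_neg_iff_add_eq_0 add.commute)
    finally show ?thesis
      using True by (simp add: r_def)
  next
    case False
    \<comment> \<open>If \<open>g ^ k = 1\<close> for all units, they would all be roots of
      \<open>X ^ s - 1\<close> with \<open>s = k mod r\<close>, which has at most
      \<open>s < r\<close> roots.\<close>
    have "\<exists>g::'a. g \<noteq> 0 \<and> g ^ k \<noteq> 1"
    proof (rule ccontr)
      assume "\<not> ?thesis"
      then have one: "g ^ k = 1" if "g \<noteq> 0" for g :: 'a
        using that by blast
      define s where "s = k mod r"
      have "r > 0"
        using finite_UNIV_card_ge_0[where 'a = 'a] one_neq_zero[where 'a = 'a]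
        by (metis One_nat_def card_1_singleton_iff UNIV_I gr0I q singletonD)
      then have s: "0 < s" "s < r"
        using False by (auto simp: s_def mod_greater_zero_iff_not_dvd)
      define P where "P = monom (1 :: 'a) s - 1"
      have "coeff P s = 1"
        using s by (simp add: P_def)
      then have "P \<noteq> 0"
        by auto
      have "degree P \<le> s"
        by (simp add: P_def degree_diff_le degree_monom_le)
      have root: "poly P g = 0" if "g \<noteq> 0" for g
      proof -
        have "g ^ k = g ^ (r * (k div r)) * g ^ s"
          unfolding s_def by (simp flip: power_add)
        then show ?thesis
          using one[OF that] unit[OF that] by (simp add: P_def poly_monom power_mult)
      qed
      have "r = card (-{0 :: 'a})"
        by (simp add: Compl_eq_Diff_UNIV card_Diff_subset r_def)
      also have "\<dots> \<le> card {x. poly P x = 0}"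
        using root by (intro card_mono) auto
      also have "\<dots> \<le> s"
        using card_poly_roots_bound[OF \<open>P \<noteq> 0\<close>] \<open>degree P \<le> s\<close> by simp
      finally show False
        using s by simp
    qed
    then obtain g :: 'a where g: "g \<noteq> 0" "g ^ k \<noteq> 1"
      by blast
    have "(\<Sum>c\<in>-{0}. c ^ k) = (\<Sum>c\<in>-{0}. (g * c) ^ k)"
      by (rule sum.reindex_bij_witness[of _ "\<lambda>c. g * c" "\<lambda>c. c / g"]) (use g in auto)
    also have "\<dots> = g ^ k * (\<Sum>c\<in>-{0}. c ^ k)"
      by (simp add: power_mult_distrib sum_distrib_left)
    finally show ?thesis
      using g False by (simp add: r_def)
  qed
qed

section \<open>Power sums over polynomials of small degree\<close>

lemma S_of_nat: "S d (int k) = (\<Sum>a\<in>monic_polys d. inverse (to_fract a) ^ k)"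
  by (simp add: S_def power_int_minus power_inverse)

text \<open>These are the differences of distinct monic polynomials of degree
  \<open>d\<close>.\<close>

definition small_polys :: "nat \<Rightarrow> 'a::finite_field poly set" where
  "small_polys d = {f. f \<noteq> 0 \<and> degree f < d}"

lemma bij_betw_smult_small_polys:
  "bij_betw (\<lambda>(a, c). smult c a) ((\<Union>e<d. monic_polys e) \<times> -{0})
     (small_polys d :: 'a::finite_field poly set)"
  by (rule bij_betwI[where g = "\<lambda>f. (smult (inverse (lead_coeff f)) f, lead_coeff f)"])
     (auto simp: small_polys_def monic_polys_def)

text \<open>Writing \<open>f\<close> as a unit times a monic polynomial factors the sum, and
  \<open>sum_power_units\<close> evaluates the factor from the units. Both the minus sign and the
  divisibility condition come from there.\<close>

lemma sum_small_polys:
  "(\<Sum>f\<in>small_polys d. inverse (to_fract f) ^ k) =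
     - (if CARD('a) - 1 dvd k then \<Sum>e<d. S e (int k) else (0 :: 'a::finite_field poly fract))"
proof -
  let ?M = "\<Union>e<d. monic_polys e :: 'a poly set"
  have minus_one: "to_fract [:- 1 :: 'a:] = - 1"
  proof -
    have "[:- 1 :: 'a:] = - 1"
      unfolding one_pCons minus_pCons by simp
    then show ?thesis
      by (simp only: to_fract_uminus to_fract_1)
  qed
  have const: "(\<Sum>c\<in>-{0 :: 'a}. inverse (to_fract [:c:]) ^ k) =
      (if CARD('a) - 1 dvd k then - 1 else 0)"
  proof -
    \<comment> \<open>Inversion permutes the units and turns negative powers into positive
      ones.\<close>
    have "(\<Sum>c\<in>-{0 :: 'a}. inverse (to_fract [:c:]) ^ k) = (\<Sum>c\<in>-{0}. to_fract [:c ^ k:])"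
    proof (rule sum.reindex_bij_witness[of _ inverse inverse])
      fix c :: 'a assume "c \<in> -{0}"
      then have "to_fract [:c:] * to_fract [:inverse c:] = 1"
        by (simp flip: to_fract_mult one_pCons)
      then have "inverse (to_fract [:c:]) = to_fract [:inverse c:]"
        by (rule inverse_unique)
      then show "to_fract [:inverse c ^ k:] = inverse (to_fract [:c:]) ^ k"
        by (simp add: poly_const_pow flip: to_fract_power)
    qed auto
    also have "\<dots> = to_fract [:\<Sum>c\<in>-{0}. c ^ k:]"
      by (simp only: sum_to_fract_const)
    finally show ?thesis
      by (simp add: sum_power_units minus_one)
  qed
  have "(\<Sum>f\<in>small_polys d. inverse (to_fract f) ^ k) =
      (\<Sum>(a, c)\<in>?M \<times> -{0}. inverse (to_fract (smult c a)) ^ k)"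
    by (subst sum.reindex_bij_betw[OF bij_betw_smult_small_polys, symmetric]) (simp add: case_prod_unfold)
  also have "\<dots> = (\<Sum>a\<in>?M. \<Sum>c\<in>-{0}. inverse (to_fract (smult c a)) ^ k)"
    by (simp add: sum.cartesian_product)
  also have "\<dots> = (\<Sum>a\<in>?M. inverse (to_fract a) ^ k * (\<Sum>c\<in>-{0}. inverse (to_fract [:c:]) ^ k))"
  proof -
    have "to_fract (smult c a) = to_fract [:c:] * to_fract a" for c and a :: "'a poly"
      by (simp flip: to_fract_mult)
    then show ?thesis
      by (simp add: power_mult_distrib sum_distrib_left mult.commute)
  qed
  also have "\<dots> = (\<Sum>a\<in>?M. inverse (to_fract a) ^ k) * (if CARD('a) - 1 dvd k then - 1 else 0)"
    by (simp add: const sum_distrib_right)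
  also have "(\<Sum>a\<in>?M. inverse (to_fract a) ^ k) = (\<Sum>e<d. S e (int k))"
    unfolding S_of_nat
    by (rule sum.UNION_disjoint) (auto simp: finite_monic_polys, auto simp: monic_polys_def)
  finally show ?thesis
    by simp
qed

section \<open>\<open>Delta\<close> as a sum over translations\<close>

lemma bij_betw_monic_polys_add:
  assumes "f \<in> small_polys d"
  shows "bij_betw (\<lambda>x. x + f) (monic_polys d) (monic_polys d)"
proof -
  have *: "x + g \<in> monic_polys d" if "x \<in> monic_polys d" "degree g < d" for x g :: "'a poly"
    using that by (auto simp: monic_polys_def degree_add_eq_left coeff_eq_0)
  show ?thesis
    using assms *[of _ f] *[of _ "- f"]
    by (intro bij_betwI[where g = "\<lambda>x. x - f"]) (auto simp: small_polys_def)
qed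

lemma bij_betw_small_polys_add:
  assumes "d \<ge> 1" and "x \<in> monic_polys d"
  shows "bij_betw (\<lambda>f. x + f) (small_polys d) (monic_polys d - {x})"
proof -
  have "degree (y - x) < d" if "y \<in> monic_polys d" for y
  proof -
    have "degree (y - x) \<le> d" and "coeff (y - x) d = 0"
      using that assms(2) by (auto simp: monic_polys_def intro: degree_diff_le)
    then show ?thesis
      using assms(1) by (metis degree_0 le_neq_implies_less leading_coeff_0_iff less_le_trans zero_less_one)
  qed
  moreover have "x + f \<in> monic_polys d" if "f \<in> small_polys d" for f
    using bij_betwE[OF bij_betw_monic_polys_add[OF that]] assms(2) by blast
  ultimately show ?thesis
    by (intro bij_betwI[where g = "\<lambda>y. y - x"]) (auto simp: small_polys_def)
qed

lemma Delta_eq_sum_shifts: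
  assumes "d \<ge> 1"
  shows "Delta d (int a) (int b) = (\<Sum>x\<in>monic_polys d. \<Sum>f\<in>small_polys d.
    inverse (to_fract x) ^ a * inverse (to_fract (x + f :: 'a::finite_field poly)) ^ b)"
proof -
  let ?M = "monic_polys d :: 'a poly set"
  have "S d (int a) * S d (int b) =
      (\<Sum>x\<in>?M. \<Sum>y\<in>?M. inverse (to_fract x) ^ a * inverse (to_fract y) ^ b)"
    by (simp add: S_of_nat sum_product)
  also have "\<dots> = (\<Sum>x\<in>?M. inverse (to_fract x) ^ (a + b) +
      (\<Sum>f\<in>small_polys d. inverse (to_fract x) ^ a * inverse (to_fract (x + f)) ^ b))"
  proof (rule sum.cong)
    fix x assume x: "x \<in> ?M"
    have "(\<Sum>y\<in>?M - {x}. inverse (to_fract x) ^ a * inverse (to_fract y) ^ b) =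
        (\<Sum>f\<in>small_polys d. inverse (to_fract x) ^ a * inverse (to_fract (x + f)) ^ b)"
      by (rule sum.reindex_bij_betw[OF bij_betw_small_polys_add[OF assms x], symmetric])
    then show "(\<Sum>y\<in>?M. inverse (to_fract x) ^ a * inverse (to_fract y) ^ b) =
        inverse (to_fract x) ^ (a + b) +
        (\<Sum>f\<in>small_polys d. inverse (to_fract x) ^ a * inverse (to_fract (x + f)) ^ b)"
      using x by (simp add: sum.remove[of _ x] finite_monic_polys power_add)
  qed simp
  finally show ?thesis
    by (simp add: Delta_def S_of_nat sum.distrib flip: of_nat_add)
qed

section \<open>Partial fractions\<close>

text \<open>With \<open>u = 1/x\<close>, \<open>v = 1/y\<close>, \<open>w = 1/(y - x)\<close> this is the partial fraction decomposition.\<close>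

lemma partial_fraction_power:
  fixes u v w :: "'a::comm_ring_1"
  assumes "u * v = w * (u - v)"
  shows "u * v ^ m = w ^ m * u - (\<Sum>k = 1..m. w ^ (m + 1 - k) * v ^ k)"
proof (induction m)
  case (Suc m)
  have "(\<Sum>k = 1..Suc m. w ^ (Suc m + 1 - k) * v ^ k) =
      w ^ Suc m * v + (\<Sum>k = 1..m. w ^ (m + 1 - k) * v ^ Suc k)"
    by (subst sum.atLeast_Suc_atMost, simp) (simp add: sum.atLeast_Suc_atMost_Suc_shift del: sum.cl_ivl_Suc)
  \<comment> \<open>After multiplying the induction hypothesis by \<open>v\<close>, the only mixed
    term is \<open>w ^ m * (u * v)\<close>. The assumption splits it, and its \<open>v\<close> part
    is the new summand \<open>k = 1\<close>.\<close>
  moreover have "u * v ^ Suc m = w ^ m * (u * v) - (\<Sum>k = 1..m. w ^ (m + 1 - k) * v ^ Suc k)"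
  proof -
    have "u * v ^ Suc m = v * (u * v ^ m)"
      by simp
    then show ?thesis
      by (simp only: Suc.IH) (simp add: right_diff_distrib sum_distrib_left mult_ac)
  qed
  ultimately show ?case
    by (simp add: assms algebra_simps)
qed simp

text \<open>The \<open>Q\<close>-th power of the assumption is
  \<open>u ^ Q * v ^ Q = w ^ Q * (u ^ Q - v ^ Q)\<close>. Multiplied by \<open>u\<close>, it leaves
  \<open>u * v ^ Q\<close> as the only mixed product, which \<open>partial_fraction_power\<close>
  expands.\<close>

lemma partial_fraction_frobenius:
  fixes u v w :: "'a::comm_ring_1"
  assumes uv: "u * v = w * (u - v)"
    and frob: "\<And>x y :: 'a. (x + y) ^ Q = x ^ Q + y ^ Q"
  shows "u ^ (Q + 1) * v ^ Q =
    w ^ Q * u ^ (Q + 1) - w ^ (2 * Q) * u + (\<Sum>k = 1..Q. w ^ (2 * Q + 1 - k) * v ^ k)"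
proof -
  have "(u - v) ^ Q = u ^ Q - v ^ Q"
    using frob[of "u - v" v] by simp
  then have "u ^ Q * v ^ Q = w ^ Q * (u ^ Q - v ^ Q)"
    using uv by (metis power_mult_distrib)
  then have "u * (u ^ Q * v ^ Q) = u * (w ^ Q * (u ^ Q - v ^ Q))"
    by simp
  then have "u ^ (Q + 1) * v ^ Q = w ^ Q * u ^ (Q + 1) - w ^ Q * (u * v ^ Q)"
    by (simp add: algebra_simps)
  moreover have "w ^ Q * (\<Sum>k = 1..Q. w ^ (Q + 1 - k) * v ^ k) =
      (\<Sum>k = 1..Q. w ^ (2 * Q + 1 - k) * v ^ k)"
    unfolding sum_distrib_left
  proof (rule sum.cong)
    fix k assume "k \<in> {1..Q}"
    then have "2 * Q + 1 - k = Q + (Q + 1 - k)"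
      by simp
    then show "w ^ Q * (w ^ (Q + 1 - k) * v ^ k) = w ^ (2 * Q + 1 - k) * v ^ k"
      by (simp only: power_add mult.assoc)
  qed simp
  ultimately show ?thesis
    by (simp add: partial_fraction_power[OF uv] right_diff_distrib mult_2 power_add mult.assoc)
qed

section \<open>Evaluation of \<open>Delta\<close> at \<open>Q + 1\<close> and
  \<open>Q\<close>\<close>

lemma Delta_frobenius:
  assumes "d \<ge> 1" and "Q \<ge> 1"
    and frob: "\<And>x y :: 'a::finite_field poly fract. (x + y) ^ Q = x ^ Q + y ^ Q"
  shows "Delta d (int (Q + 1)) (int Q) = - (\<Sum>k\<in>{k \<in> {2..Q + 1}. CARD('a) - 1 dvd 2 * Q + 1 - k}.
    S2 d (int k) (int (2 * Q + 1 - k)) :: 'a poly fract)"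
proof -
  let ?M = "monic_polys d :: 'a poly set" and ?N = "small_polys d :: 'a poly set"
  define s :: "nat \<Rightarrow> 'a poly fract" where "s k = S d (int k)" for k
  define t where "t k = (\<Sum>f\<in>?N. inverse (to_fract f) ^ k)" for k
  have st: "t j * s k = (\<Sum>x\<in>?M. \<Sum>f\<in>?N. inverse (to_fract f) ^ j * inverse (to_fract x) ^ k)"
    for j k
    unfolding s_def t_def S_of_nat sum_product by (rule sum.swap)
  \<comment> \<open>For fixed \<open>f\<close>, translation by \<open>f\<close> permutes the monic
    polynomials, so the shift does not change the sum.\<close>
  have st': "t j * s k = (\<Sum>x\<in>?M. \<Sum>f\<in>?N. inverse (to_fract f) ^ j * inverse (to_fract (x + f)) ^ k)"
    for j k
  proof -
    have "t j * s k = (\<Sum>f\<in>?N. \<Sum>x\<in>?M. inverse (to_fract f) ^ j * inverse (to_fract x) ^ k)"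
      unfolding s_def t_def S_of_nat sum_product ..
    also have "\<dots> = (\<Sum>f\<in>?N. \<Sum>x\<in>?M. inverse (to_fract f) ^ j * inverse (to_fract (x + f)) ^ k)"
      by (intro sum.cong refl sum.reindex_bij_betw[symmetric] bij_betw_monic_polys_add)
    finally show ?thesis
      by (subst sum.swap)
  qed
  have "Delta d (int (Q + 1)) (int Q) = (\<Sum>x\<in>?M. \<Sum>f\<in>?N.
      inverse (to_fract f) ^ Q * inverse (to_fract x) ^ (Q + 1)
      - inverse (to_fract f) ^ (2 * Q) * inverse (to_fract x) ^ 1
      + (\<Sum>k = 1..Q. inverse (to_fract f) ^ (2 * Q + 1 - k) * inverse (to_fract (x + f)) ^ k))"
    unfolding Delta_eq_sum_shifts[OF assms(1)]
  proof (intro sum.cong refl)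
    fix x f :: "'a poly" assume x: "x \<in> ?M" and f: "f \<in> ?N"
    have "x + f \<in> ?M"
      using bij_betwE[OF bij_betw_monic_polys_add[OF f]] x by blast
    then have "to_fract x \<noteq> 0" "to_fract (x + f) \<noteq> 0" "to_fract f \<noteq> 0"
      using x f by (auto simp only: to_fract_eq_0_iff) (auto simp: monic_polys_def small_polys_def)
    then have "inverse (to_fract x) * inverse (to_fract (x + f)) =
        inverse (to_fract f) * (inverse (to_fract x) - inverse (to_fract (x + f)))"
      by (simp add: field_simps)
    from partial_fraction_frobenius[OF this frob]
    show "inverse (to_fract x) ^ (Q + 1) * inverse (to_fract (x + f)) ^ Q =
      inverse (to_fract f) ^ Q * inverse (to_fract x) ^ (Q + 1)
      - inverse (to_fract f) ^ (2 * Q) * inverse (to_fract x) ^ 1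
      + (\<Sum>k = 1..Q. inverse (to_fract f) ^ (2 * Q + 1 - k) * inverse (to_fract (x + f)) ^ k)"
      by simp
  qed
  also have "\<dots> = t Q * s (Q + 1) - t (2 * Q) * s 1 + (\<Sum>k = 1..Q. t (2 * Q + 1 - k) * s k)"
  proof -
    have "(\<Sum>k = 1..Q. t (2 * Q + 1 - k) * s k) = (\<Sum>x\<in>?M. \<Sum>f\<in>?N. \<Sum>k = 1..Q.
        inverse (to_fract f) ^ (2 * Q + 1 - k) * inverse (to_fract (x + f)) ^ k)"
      unfolding st' by (subst sum.swap, rule sum.cong[OF refl], rule sum.swap)
    then show ?thesis
      by (simp only: st sum.distrib sum_subtractf)
  qed
  \<comment> \<open>The summand \<open>k = 1\<close> cancels \<open>t (2 * Q) * s 1\<close>, and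
    \<open>t Q * s (Q + 1)\<close> becomes the summand \<open>k = Q + 1\<close>.\<close>
  also have "\<dots> = (\<Sum>k = 2..Q + 1. t (2 * Q + 1 - k) * s k)"
  proof -
    have "(\<Sum>k = 1..Q. t (2 * Q + 1 - k) * s k) =
        t (2 * Q) * s 1 + (\<Sum>k = 2..Q. t (2 * Q + 1 - k) * s k)"
      using assms(2) by (subst sum.atLeast_Suc_atMost) (auto simp: numeral_2_eq_2)
    moreover have "(\<Sum>k = 2..Q + 1. t (2 * Q + 1 - k) * s k) =
        (\<Sum>k = 2..Q. t (2 * Q + 1 - k) * s k) + t Q * s (Q + 1)"
      using assms(2) by simp
    ultimately show ?thesis
      by simp
  qed
  also have "\<dots> = (\<Sum>k = 2..Q + 1. - (if CARD('a) - 1 dvd 2 * Q + 1 - k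
      then S2 d (int k) (int (2 * Q + 1 - k)) else 0))"
    by (intro sum.cong refl)
       (simp add: t_def s_def sum_small_polys S2_def mult.commute del: of_nat_add of_nat_diff)
  also have "\<dots> = - (\<Sum>k\<in>{k \<in> {2..Q + 1}. CARD('a) - 1 dvd 2 * Q + 1 - k}.
    S2 d (int k) (int (2 * Q + 1 - k)))"
    unfolding sum_negf by (subst sum.inter_filter) simp_all
  finally show ?thesis .
qed

section \<open>The surviving indices and the final formula\<close>

lemma Suc_power_eq: "\<exists>N. Suc r ^ n = N * r + 1"
proof (induction n)
  case (Suc n)
  then obtain N where "Suc r ^ n = N * r + 1" ..
  then have "Suc r ^ Suc n = (Suc r * N + 1) * r + 1"
    by (simp add: algebra_simps)
  then show ?case ..
qed auto

theorem theorem3p1: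
  fixes p m q n d :: nat
  assumes "prime p" and "m \<ge> 1" and "q = p ^ m"
    and "CARD('a::finite_field) = q"
    and "n \<ge> 1" and "d \<ge> 1"
  shows "(Delta d (int q ^ n + 1) (int q ^ n) :: 'a poly fract) =
    of_nat (Int_ind (2 / of_nat q)) * S2 d 2 (2 * int q ^ n - 1)
    - (\<Sum>j = 1..(q ^ n - 1) div (q - 1).
         S2 d (3 + (int j - 1) * (int q - 1)) (2 * int q ^ n - 2 - (int j - 1) * (int q - 1)))"
proof -
  define Q where "Q = q ^ n"
  have q2: "q \<ge> 2"
    using assms by (metis One_nat_def power_increasing power_one_right prime_ge_1_nat prime_ge_2_nat le_trans)
  define r where "r = q - 1"
  have r: "r \<ge> 1" "q = r + 1"
    using q2 by (auto simp: r_def)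
  \<comment> \<open>\<open>N\<close> is the number of terms of the sum over
    \<open>j\<close>.\<close>
  obtain N where QN: "Q = N * r + 1"
    using Suc_power_eq[of r n] r by (auto simp: Q_def)
  have div_eq: "(q ^ n - 1) div (q - 1) = N"
    using QN r(1) unfolding Q_def r_def by simp
  have "CHAR('a) = p"
    using CHAR_finite_field assms(1,3,4) by blast
  then have char: "CHAR('a poly fract) = p"
    by (simp add: CHAR_fract)
  have frob: "(x + y) ^ Q = x ^ Q + y ^ Q" for x y :: "'a poly fract"
    by (rule freshmans_dream'[where n = "m * n"])
       (use assms in \<open>auto simp: char Q_def power_mult\<close>)
  define F where "F k = (S2 d (int k) (int (2 * Q + 1 - k)) :: 'a poly fract)" for k
  \<comment> \<open>\<open>h\<close> lists the indices \<open>k \<ge> 3\<close> congruent to 3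
    modulo \<open>r\<close>, starting with \<open>h 1 = 3\<close>.\<close>
  define h where "h j = 3 + (j - 1) * r" for j
  have inj: "inj_on h {1..N}"
    using r by (auto simp: inj_on_def h_def)
  \<comment> \<open>The two numbers add up to \<open>2 * Q - 2 = r * (2 * N)\<close>.\<close>
  have dvd_iff: "r dvd 2 * Q + 1 - k \<longleftrightarrow> r dvd k - 3" if "3 \<le> k" "k \<le> Q + 1" for k
  proof -
    have "(2 * Q + 1 - k) + (k - 3) = r * (2 * N)"
      using that QN by (simp add: algebra_simps)
    then show ?thesis
      by (metis dvd_add_right_iff dvd_add_left_iff dvd_triv_left)
  qed
  \<comment> \<open>The progression stops at \<open>j = N\<close>: \<open>h N = Q + 2 - r\<close> is
    at most \<open>Q + 1\<close>, while the next value \<open>3 + N * r\<close> is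
    \<open>Q + 2\<close>.\<close>
  have image: "{k \<in> {3..Q + 1}. r dvd 2 * Q + 1 - k} = h ` {1..N}"
  proof (intro equalityI subsetI)
    fix k assume k: "k \<in> {k \<in> {3..Q + 1}. r dvd 2 * Q + 1 - k}"
    then have "r dvd k - 3"
      using dvd_iff[of k] by auto
    then obtain i where i: "k - 3 = r * i" ..
    have "3 \<le> k" "k \<le> r * N + 2"
      using k QN by (simp_all add: mult.commute)
    then have "r * i < r * N"
      using i by linarith
    then have "i < N"
      by simp
    moreover have "k = h (Suc i)"
      using k i by (auto simp: h_def algebra_simps)
    ultimately show "k \<in> h ` {1..N}"
      by (intro image_eqI[of _ _ "Suc i"]) auto
  next
    fix k assume "k \<in> h ` {1..N}"
    then obtain j where j: "1 \<le> j" "j \<le> N" "k = h j"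
      by auto
    have "(j - 1) * r + r \<le> N * r"
      using j by (metis Suc_pred' add.commute less_le_trans mult_Suc mult_le_mono1 zero_less_one)
    then have "3 \<le> k" "k \<le> Q + 1"
      using j(3) r QN by (auto simp: h_def)
    then show "k \<in> {k \<in> {3..Q + 1}. r dvd 2 * Q + 1 - k}"
      using dvd_iff[of k] j(3) by (simp add: h_def)
  qed
  \<comment> \<open>\<open>2 * Q - 1\<close> is 1 modulo \<open>r\<close>, so \<open>r\<close>
    divides it only if \<open>r = 1\<close>.\<close>
  have two: "r dvd 2 * Q + 1 - 2 \<longleftrightarrow> q = 2"
  proof -
    have "2 * Q + 1 - 2 = 1 + r * (2 * N)"
      using QN by (simp add: algebra_simps)
    then have "r dvd 2 * Q + 1 - 2 \<longleftrightarrow> r = 1"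
      by (simp only: dvd_add_left_iff[OF dvd_triv_left] nat_dvd_1_iff_1)
    then show ?thesis
      using r by auto
  qed
  have Q: "Q \<ge> 1"
    using QN by simp
  have "{2..Q + 1} = insert 2 {3..Q + 1}"
    using Q by auto
  then have "{k \<in> {2..Q + 1}. r dvd 2 * Q + 1 - k} = (if q = 2 then {2} else {}) \<union> h ` {1..N}"
    using two image by auto
  then have "Delta d (int (Q + 1)) (int Q) = - (\<Sum>k\<in>(if q = 2 then {2} else {}) \<union> h ` {1..N}. F k)"
    using Delta_frobenius[OF assms(6) Q frob] by (simp add: assms(4) r_def F_def)
  also have "\<dots> = - (if q = 2 then F 2 else 0) - (\<Sum>j = 1..N. F (h j))"
  proof -
    have "2 \<notin> h ` {1..N}"
      by (auto simp: h_def)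
    moreover have "sum F (h ` {1..N}) = (\<Sum>j = 1..N. F (h j))"
      by (simp only: sum.reindex[OF inj] comp_def)
    ultimately show ?thesis
      by simp
  qed
  also have "- (if q = 2 then F 2 else 0) = of_nat (Int_ind (2 / of_nat q)) * F 2"
  proof (cases "q = 2")
    case True
    then have "p = 2"
      using assms(1-3) dvd_power[of m p] by (intro primes_dvd_imp_eq) auto
    then show ?thesis
      using True char uminus_CHAR_2[of "F 2"] by (simp add: Int_ind_def)
  next
    case False
    have "(2 / of_nat q :: rat) \<notin> \<int>"
    proof
      assume "(2 / of_nat q :: rat) \<in> \<int>"
      then obtain k where "(2 / of_nat q :: rat) = of_int k"
        by (elim Ints_cases)
      then have "(of_int 2 :: rat) = of_int (k * int q)"
        using q2 by (simp add: field_simps)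
      then have "2 = k * int q"
        by (simp only: of_int_eq_iff)
      then have "int q dvd 2"
        by (rule dvdI[OF trans[OF _ mult.commute]])
      then have "q dvd 2"
        using int_dvd_int_iff[of q 2] by simp
      then show False
        using False q2 by (auto dest: dvd_imp_le)
    qed
    then show ?thesis
      using False by (simp add: Int_ind_def)
  qed
  also have "F 2 = S2 d 2 (2 * int q ^ n - 1)"
    using Q by (simp add: F_def Q_def)
  also have "(\<Sum>j = 1..N. F (h j)) = (\<Sum>j = 1..(q ^ n - 1) div (q - 1).
      S2 d (3 + (int j - 1) * (int q - 1)) (2 * int q ^ n - 2 - (int j - 1) * (int q - 1)))"
    unfolding div_eq
  proof (rule sum.cong[OF refl])
    fix j assume "j \<in> {1..N}"
    then have j: "1 \<le> j" and "h j \<in> {k \<in> {3..Q + 1}. r dvd 2 * Q + 1 - k}"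
      unfolding image by auto
    \<comment> \<open>With this bound the natural subtraction \<open>2 * Q + 1 - h j\<close> agrees
      with the integer one.\<close>
    then have "h j \<le> 2 * Q + 1"
      by simp
    moreover have h: "int (h j) = 3 + (int j - 1) * (int q - 1)"
      using j r by (simp add: h_def)
    ultimately have
      "int (2 * Q + 1 - h j) = 2 * int q ^ n - 2 - (int j - 1) * (int q - 1)"
      by (simp add: Q_def)
    with h show "F (h j) = S2 d (3 + (int j - 1) * (int q - 1))
        (2 * int q ^ n - 2 - (int j - 1) * (int q - 1))"
      by (simp only: F_def)
  qed
  also have "int (Q + 1) = int q ^ n + 1"
    by (simp add: Q_def)
  also have "int Q = int q ^ n"
    by (simp add: Q_def)
  finally show ?thesis .
qed

end
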